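(* Let $C,\Omega\in\mathbb R^{m\times m}$ with $C=C^\top$. Let $(x_t^H,\mu_t^H)$ be generated by $ALG(C,\Omega)$ and let $(x_t^P,\nu_t^P)$ be generated by $ALG(0,C+\Omega)$ (where $\nu^P$ denotes the dual variable of the latter method), both with the same $f$, $h$, $\eta_x$, $\eta_{\rm d}$. Suppose the two methods have the same primal history, $x_{-1}^{P}=x_{-1}^{H}$ and $x_0^{P}=x_0^{H}$, and matched effective-dual initialization $\nu_0^P=\mu_0^H+C\,h(x_{-1}^H)$. Then, for every $t\ge 0$, $$x_t^P=x_t^H,\qquad \nu_t^P=\mu_t^H+C\,h(x_{t-1}^H).$$ In particular, the two methods generate identical primal trajectories.
   Context: Let $f:\mathbb R^d\to\mathbb R$ and $h:\mathbb R^d\to\mathbb R^m$ be differentiable, with Jacobian $J_h(x)\in\mathbb R^{m\times d}$, and fix step sizes $\eta_x>0$, $\eta_{\rm d}>0$. For matrices $C,\Omega\in\mathbb R^{m\times m}$, the hybrid method $ALG(C,\Omega)$, started from given $x_{-1},x_0\in\mathbb R^d$ and $\mu_0\in\mathbb R^m$, is the iteration, for $t\ge 0$, $$\mu_{t+1}=\mu_t+\eta_{\rm d}h(x_t)+\Omega\big(h(x_t)-h(x_{t-1})\big),$$ $$x_{t+1}=x_t-\eta_x\Big[\nabla f(x_t)+J_h(x_t)^\top\big(\mu_{t+1}+C\,h(x_t)\big)\Big].$$ *)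

theory Defs
  imports "HOL-Analysis.Analysis"
begin

definition gradient :: "('a::real_inner \<Rightarrow> real) \<Rightarrow> 'a \<Rightarrow> 'a" where
  "gradient f x = (THE D. GDERIV f x :> D)"

lemma GDERIV_gradient:
  fixes f :: "'a::euclidean_space \<Rightarrow> real"
  assumes "f differentiable (at x)"
  shows "GDERIV f x :> gradient f x"
proof -
  let ?f' = "frechet_derivative f (at x)"
  have der: "(f has_derivative ?f') (at x)"
    using assms by (simp add: frechet_derivative_works)
  then have lin: "linear ?f'"
    by (rule has_derivative_linear)
  have "?f' = (\<lambda>v. inner v (adjoint ?f' 1))"
    using adjoint_works[OF lin, of _ 1] by (simp add: fun_eq_iff)
  with der have ex: "GDERIV f x :> adjoint ?f' 1"
    by (simp add: gderiv_def)
  have uniq: "D = D'" if "GDERIV f x :> D" "GDERIV f x :> D'" for D D'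
  proof -
    have "(\<lambda>v. inner v D) = (\<lambda>v. inner v D')"
      using that unfolding gderiv_def by (rule has_derivative_unique)
    then show ?thesis
      using vector_eq_ldot[of D D'] by (simp add: fun_eq_iff)
  qed
  show ?thesis
    unfolding gradient_def by (rule theI[where P = "\<lambda>D. GDERIV f x :> D", OF ex uniq[OF _ ex]])
qed

text \<open>
  The sequences are indexed by integers so that the history point \<open>x (-1)\<close> is available;
  only \<open>x t\<close> for \<open>t \<ge> -1\<close> and \<open>\<mu> t\<close> for \<open>t \<ge> 0\<close> are constrained, and the starting values
  \<open>x (-1)\<close>, \<open>x 0\<close>, \<open>\<mu> 0\<close> are arbitrary.
\<close>

definition generated_by_ALG ::
  "(real ^ 'd \<Rightarrow> real) \<Rightarrow> (real ^ 'd \<Rightarrow> real ^ 'm) \<Rightarrow> real \<Rightarrow> real \<Rightarrow>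
   real ^ 'm ^ 'm \<Rightarrow> real ^ 'm ^ 'm \<Rightarrow> (int \<Rightarrow> real ^ 'd) \<Rightarrow> (int \<Rightarrow> real ^ 'm) \<Rightarrow> bool" where
  "generated_by_ALG f h \<eta>\<^sub>x \<eta>\<^sub>d C \<Omega> x \<mu> \<longleftrightarrow>
    (\<forall>t\<ge>0.
      \<mu> (t + 1) = \<mu> t + \<eta>\<^sub>d *\<^sub>R h (x t) + \<Omega> *v (h (x t) - h (x (t - 1))) \<and>
      x (t + 1) = x t - \<eta>\<^sub>x *\<^sub>R
        (gradient f (x t) + transpose (jacobian h (at (x t))) *v (\<mu> (t + 1) + C *v h (x t))))"

end

theory Submission
  imports Defs
begin

text \<open>The primal step of the hybrid method sees the dual variable only through the effective
  multiplier \<open>\<mu>H (t + 1) + C *v h (xH t)\<close>. Along a common primal path, the extra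
  term \<open>C *v (h (x t) - h (x (t - 1)))\<close> in the update of \<open>\<nu>P\<close> is
  exactly the change of the offset \<open>C *v h (x (t - 1))\<close>. So \<open>\<nu>P\<close>
  tracks the effective multiplier, and the primal steps coincide.\<close>

theorem theorem1:
  fixes f :: "real ^ 'd \<Rightarrow> real" and h :: "real ^ 'd \<Rightarrow> real ^ 'm"
    and \<eta>\<^sub>x \<eta>\<^sub>d :: real
    and C \<Omega> :: "real ^ 'm ^ 'm"
    and xH xP :: "int \<Rightarrow> real ^ 'd" and \<mu>H \<nu>P :: "int \<Rightarrow> real ^ 'm"
  assumes "\<And>x. f differentiable (at x)"
    and "\<And>x. h differentiable (at x)"
    and "\<eta>\<^sub>x > 0" and "\<eta>\<^sub>d > 0"
    and "C = transpose C"
    and "generated_by_ALG f h \<eta>\<^sub>x \<eta>\<^sub>d C \<Omega> xH \<mu>H"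
    and "generated_by_ALG f h \<eta>\<^sub>x \<eta>\<^sub>d 0 (C + \<Omega>) xP \<nu>P"
    and "xP (-1) = xH (-1)" and "xP 0 = xH 0"
    and "\<nu>P 0 = \<mu>H 0 + C *v h (xH (-1))"
  shows "(\<forall>t\<ge>0. xP t = xH t \<and> \<nu>P t = \<mu>H t + C *v h (xH (t - 1))) \<and>
    (\<forall>t\<ge>-1. xP t = xH t)"
proof -
  have H: "\<mu>H (t + 1) = \<mu>H t + \<eta>\<^sub>d *\<^sub>R h (xH t) + \<Omega> *v (h (xH t) - h (xH (t - 1)))"
      "xH (t + 1) = xH t - \<eta>\<^sub>x *\<^sub>R
        (gradient f (xH t) + transpose (jacobian h (at (xH t))) *v (\<mu>H (t + 1) + C *v h (xH t)))"
    and P: "\<nu>P (t + 1) = \<nu>P t + \<eta>\<^sub>d *\<^sub>R h (xP t) + (C + \<Omega>) *v (h (xP t) - h (xP (t - 1)))"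
      "xP (t + 1) = xP t - \<eta>\<^sub>x *\<^sub>R
        (gradient f (xP t) + transpose (jacobian h (at (xP t))) *v \<nu>P (t + 1))"
    if "t \<ge> 0" for t
    using assms(6,7) that unfolding generated_by_ALG_def by simp_all
  \<comment> \<open>Agreement at \<open>t - 1\<close> is carried along because the dual update also
    reads \<open>h (x (t - 1))\<close>; at \<open>t = 0\<close> it is the shared history
    point.\<close>
  have inv: "xP (t - 1) = xH (t - 1) \<and> xP t = xH t \<and> \<nu>P t = \<mu>H t + C *v h (xH (t - 1))"
    if "t \<ge> 0" for t
    using that
  proof (induction t rule: int_ge_induct)
    case base
    show ?case using assms(8-10) by simp
  next
    case (step t)
    \<comment> \<open>By linearity the old offset \<open>C *v h (xH (t - 1))\<close> cancels,
      leaving the new one.\<close>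
    then have dual: "\<nu>P (t + 1) = \<mu>H (t + 1) + C *v h (xH t)"
      unfolding H(1)[OF step.hyps] P(1)[OF step.hyps]
      by (simp add: matrix_vector_mult_add_rdistrib matrix_vector_mult_diff_distrib)
    with step have "xP (t + 1) = xH (t + 1)"
      by (simp add: H(2) P(2))
    with dual step show ?case by simp
  qed
  \<comment> \<open>Shifting by one lets the \<open>t - 1\<close> component of \<open>inv\<close>
    reach index \<open>-1\<close>.\<close>
  have "xP t = xH t" if "t \<ge> -1" for t
    using inv[of "t + 1"] that by simp
  with inv show ?thesis by blast
qed

end
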